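(* For every topological model $\mathcal{M}=((X,\tau),\nu)$ and every formula $\varphi$: $$\llbracket\Diamond_c\varphi\rrbracket^{\mathcal{M}}=\mathrm{cl}(\llbracket\varphi\rrbracket^{\mathcal{M}}).$$ In particular, $\llbracket\Box_c\varphi\rrbracket^{\mathcal{M}}=\mathrm{int}(\llbracket\varphi\rrbracket^{\mathcal{M}})$.
   Context: Nonstandard setting. For a topological space $(X,\tau)$ let $S=X\cup\mathbb{R}$ and let $V(S)=\bigcup_{k\in\mathbb{N}_0}V_k(S)$ be the superstructure over $S$, where $V_0(S)=S$ and $V_{k+1}(S)=V_k(S)\cup\mathcal{P}(V_k(S))$. A polysaturated nonstandard model is a superstructure $V({}^*S)$ with a star map $A\mapsto{}^*A$ from $V(S)$ to $V({}^*S)$ such that: (1) Extension: ${}^*s=s$ for all $s\in S$; (2) Transfer: a bounded quantifier formula $\Phi(A_1,\dots,A_n)$ is true in $V(S)$ iff $\Phi({}^*A_1,\dots,{}^*A_n)$ is true in $V({}^*S)$; (3) Saturation: every family of internal sets of cardinality at most $\kappa$ with the finite intersection property has non-empty intersection, where $\kappa\ge|V(S)|$ is a fixed cardinal. A set is internal if it is an element of ${}^*C$ for some $C\in V(S)$. One such model is fixed throughout. In particular $X\subseteq{}^*X$. Halo. For $x\in X$, $\mathcal{N}(x)=\{U\in\tau: x\in U\}$ and $\mu(x)=\bigcap_{U\in\mathcal{N}(x)}{}^*U$. Modal semantics. Formulas are built from propositional variables, $\bot$, $\neg$, $\wedge$ and a unary $\Diamond_c$, with $\Box_c\varphi:=\neg\Diamond_c\neg\varphi$.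 A topological model is $\mathcal{M}=((X,\tau),\nu)$ with $(X,\tau)$ a topological space and $\nu$ a map from propositional variables to $\mathcal{P}(X)$. The extension $\llbracket\varphi\rrbracket^{\mathcal{M}}\subseteq X$ is defined with $\llbracket p\rrbracket=\nu(p)$, Boolean clauses as usual, and $\llbracket\Diamond_c\varphi\rrbracket=\{x\in X:\mu(x)\cap{}^*\llbracket\varphi\rrbracket\neq\emptyset\}$. $\mathrm{cl}$ and $\mathrm{int}$ denote topological closure and interior. *)

theory Defs
  imports "HOL-Analysis.Abstract_Topology"
begin

unbundle cardinal_syntax

section \<open>Superstructures\<close>

text \<open>
  No HOL type constructor yields the full superstructure over an arbitrary set of individuals,
  so superstructures are taken inside a type \<open>'u\<close> of individuals and sets.  A partial map
  \<open>E :: 'u \<rightharpoonup> 'u set\<close> says what an object is: \<open>E u = None\<close> means that \<open>u\<close> is an individual, and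
  \<open>E u = Some B\<close> means that \<open>u\<close> is the set whose elements are exactly those in \<open>B\<close>.
\<close>

definition extensional :: "('u \<rightharpoonup> 'u set) \<Rightarrow> bool" where
  "extensional E \<longleftrightarrow> inj_on E (dom E)"

definition elts :: "('u \<rightharpoonup> 'u set) \<Rightarrow> 'u \<Rightarrow> 'u set" where
  "elts E u = (case E u of None \<Rightarrow> {} | Some B \<Rightarrow> B)"

primrec level :: "('u \<rightharpoonup> 'u set) \<Rightarrow> 'u set \<Rightarrow> nat \<Rightarrow> 'u set" where
  "level E S 0 = S"
| "level E S (Suc k) = level E S k \<union> {u. \<exists>B. E u = Some B \<and> B \<subseteq> level E S k}"

definition superstr :: "('u \<rightharpoonup> 'u set) \<Rightarrow> 'u set \<Rightarrow> 'u set" where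
  "superstr E S = (\<Union>k. level E S k)"

text \<open>
  The members of \<open>S\<close> are individuals, and every subset of \<open>V\<^sub>k(S)\<close> is an object of \<open>'u\<close>, so that
  \<open>level E S (Suc k)\<close> really is the union of \<open>V\<^sub>k(S)\<close> with its full power set.
\<close>

definition superstr_over :: "('u \<rightharpoonup> 'u set) \<Rightarrow> 'u set \<Rightarrow> bool" where
  "superstr_over E S \<longleftrightarrow>
     (\<forall>s\<in>S. E s = None) \<and> (\<forall>k. \<forall>B. B \<subseteq> level E S k \<longrightarrow> (\<exists>u. E u = Some B))"

definition mkset :: "('u \<rightharpoonup> 'u set) \<Rightarrow> 'u set \<Rightarrow> 'u" where
  "mkset E B = (THE u. E u = Some B)"

section \<open>Bounded quantifier formulas\<close>

text \<open>
  \<open>BQ_All i j \<Phi>\<close> stands for \<open>\<forall>x\<^sub>i \<in> x\<^sub>j. \<Phi>\<close>.  The parameters \<open>A\<^sub>1, \<dots>, A\<^sub>n\<close> are the values that an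
  assignment gives to the free variables.
\<close>

datatype bqform =
    BQ_Eq nat nat
  | BQ_In nat nat
  | BQ_Not bqform
  | BQ_And bqform bqform
  | BQ_All nat nat bqform

primrec bq_true :: "('u \<rightharpoonup> 'u set) \<Rightarrow> 'u set \<Rightarrow> bqform \<Rightarrow> (nat \<Rightarrow> 'u) \<Rightarrow> bool" where
  "bq_true E D (BQ_Eq i j) a \<longleftrightarrow> a i = a j"
| "bq_true E D (BQ_In i j) a \<longleftrightarrow> a i \<in> elts E (a j)"
| "bq_true E D (BQ_Not \<Phi>) a \<longleftrightarrow> \<not> bq_true E D \<Phi> a"
| "bq_true E D (BQ_And \<Phi> \<Psi>) a \<longleftrightarrow> bq_true E D \<Phi> a \<and> bq_true E D \<Psi> a"
| "bq_true E D (BQ_All i j \<Phi>) a \<longleftrightarrow>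
     (\<forall>u\<in>D. u \<in> elts E (a j) \<longrightarrow> bq_true E D \<Phi> (a(i := u)))"

section \<open>Polysaturated nonstandard models\<close>

definition star_set :: "('u \<rightharpoonup> 'u set) \<Rightarrow> ('u \<Rightarrow> 'u) \<Rightarrow> 'u set \<Rightarrow> 'u set" where
  "star_set E star A = elts E (star (mkset E A))"

definition internal_set :: "('u \<rightharpoonup> 'u set) \<Rightarrow> 'u set \<Rightarrow> ('u \<Rightarrow> 'u) \<Rightarrow> 'u set \<Rightarrow> bool" where
  "internal_set E S star B \<longleftrightarrow>
     (\<exists>u. E u = Some B \<and> (\<exists>C \<in> superstr E S. u \<in> elts E (star C)))"

text \<open>In the saturation clause, \<open>\<F> = {}\<close> is harmless, since \<open>\<Inter>{} = UNIV\<close>.\<close>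

definition polysaturated_model ::
    "('u \<rightharpoonup> 'u set) \<Rightarrow> 'u set \<Rightarrow> ('u \<Rightarrow> 'u) \<Rightarrow> 'k rel \<Rightarrow> bool" where
  "polysaturated_model E S star \<kappa> \<longleftrightarrow>
     extensional E \<and> superstr_over E S \<and> superstr_over E (star_set E star S) \<and>
     star ` superstr E S \<subseteq> superstr E (star_set E star S) \<and>
     (\<forall>s\<in>S. star s = s) \<and>
     (\<forall>\<Phi> a. range a \<subseteq> superstr E S \<longrightarrow>
        (bq_true E (superstr E S) \<Phi> a \<longleftrightarrow>
         bq_true E (superstr E (star_set E star S)) \<Phi> (star \<circ> a))) \<and>
     Card_order \<kappa> \<and> |superstr E S| \<le>o \<kappa> \<and>
     (\<forall>\<F>. (\<forall>B\<in>\<F>. internal_set E S star B) \<and> |\<F>| \<le>o \<kappa> \<and>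
        (\<forall>\<G>. \<G> \<subseteq> \<F> \<and> finite \<G> \<longrightarrow> \<Inter>\<G> \<noteq> {}) \<longrightarrow> \<Inter>\<F> \<noteq> {})"

definition halo :: "('u \<rightharpoonup> 'u set) \<Rightarrow> ('u \<Rightarrow> 'u) \<Rightarrow> 'u topology \<Rightarrow> 'u \<Rightarrow> 'u set" where
  "halo E star T x = (\<Inter>U\<in>{U. openin T U \<and> x \<in> U}. star_set E star U)"

section \<open>Modal formulas and their extensions\<close>

datatype 'p form =
    PVar 'p
  | Falsum
  | Neg "'p form"
  | Conj "'p form" "'p form"
  | Dia "'p form"

definition Box :: "'p form \<Rightarrow> 'p form" where
  "Box \<phi> = Neg (Dia (Neg \<phi>))"

primrec ext ::
    "('u \<rightharpoonup> 'u set) \<Rightarrow> ('u \<Rightarrow> 'u) \<Rightarrow> 'u topology \<Rightarrow> ('p \<Rightarrow> 'u set) \<Rightarrow> 'p form \<Rightarrow> 'u set" where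
  "ext E star T \<nu> (PVar p) = \<nu> p"
| "ext E star T \<nu> Falsum = {}"
| "ext E star T \<nu> (Neg \<phi>) = topspace T - ext E star T \<nu> \<phi>"
| "ext E star T \<nu> (Conj \<phi> \<psi>) = ext E star T \<nu> \<phi> \<inter> ext E star T \<nu> \<psi>"
| "ext E star T \<nu> (Dia \<phi>) =
     {x \<in> topspace T. halo E star T x \<inter> star_set E star (ext E star T \<nu> \<phi>) \<noteq> {}}"

end

theory Submission
  imports Defs
begin

text \<open>
  The content lies in a single equivalence for a set \<open>A\<close> of points: \<open>x\<close> is in the closure of \<open>A\<close>
  iff the halo of \<open>x\<close> meets \<open>*A\<close>.

  If \<open>y\<close> is in the halo and in \<open>*A\<close>, then \<open>*U\<close> meets \<open>*A\<close> for each open neighbourhood \<open>U\<close>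
  of \<open>x\<close>.  By transfer of the bounded formula \<open>\<forall>z\<in>U. z \<notin> A\<close>, disjoint sets have disjoint star
  images (\<open>star_set_disjoint\<close>), so \<open>U\<close> meets \<open>A\<close>.

  Conversely, if \<open>x\<close> is in the closure, consider the family that consists of \<open>*A\<close> and of all
  \<open>*U\<close>.  Finitely many of the standard sets share a point with \<open>A\<close>, and this point lies in the
  corresponding star images as well, because \<open>B \<subseteq> *B\<close> (\<open>subset_star_set\<close>).  The family
  therefore has the finite intersection property.  It is indexed by objects of the superstructure,
  which bounds its cardinality, and so saturation (\<open>star_sets_saturated\<close>) gives a point of \<open>*A\<close>
  in the halo of \<open>x\<close>.

  The clause for \<open>\<diamond>\<close> is an instance of this equivalence, and the clause for \<open>\<box>\<close> follows from it
  since the interior is the complement of the closure of the complement.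
\<close>

lemma elts_level: "superstr_over E S \<Longrightarrow> u \<in> level E S k \<Longrightarrow> elts E u \<subseteq> level E S k"
  by (induction k) (auto simp: superstr_over_def elts_def split: option.splits)

lemma elts_superstr: "superstr_over E S \<Longrightarrow> u \<in> superstr E S \<Longrightarrow> elts E u \<subseteq> superstr E S"
  using elts_level unfolding superstr_def by fast

lemma mkset_eq:
  assumes "extensional E" "superstr_over E S" "B \<subseteq> level E S k"
  shows "E (mkset E B) = Some B"
proof -
  have "\<exists>!u. E u = Some B"
    using assms unfolding superstr_over_def extensional_def inj_on_def by (metis domI)
  then show ?thesis unfolding mkset_def by (rule theI')
qed

lemma mkset_level:
  assumes "extensional E" "superstr_over E S" "B \<subseteq> level E S k"
  shows "mkset E B \<in> level E S (Suc k)"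
  using mkset_eq[OF assms] assms(3) by auto

lemma mkset_superstr:
  assumes "extensional E" "superstr_over E S" "B \<subseteq> S"
  shows "mkset E B \<in> superstr E S"
proof -
  have "mkset E B \<in> level E S (Suc 0)"
    using assms by (intro mkset_level) simp_all
  then show ?thesis unfolding superstr_def by blast
qed

context
  fixes E :: "'u \<rightharpoonup> 'u set" and S :: "'u set" and star :: "'u \<Rightarrow> 'u" and \<kappa> :: "'k rel"
  assumes model: "polysaturated_model E S star \<kappa>"
begin

lemma ext_E: "extensional E"
  and over_S: "superstr_over E S"
  and over_star_S: "superstr_over E (star_set E star S)"
  and star_image: "star ` superstr E S \<subseteq> superstr E (star_set E star S)"
  and star_individuals: "\<forall>s\<in>S. star s = s"
  and card_superstr: "|superstr E S| \<le>o \<kappa>"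
  using model unfolding polysaturated_model_def by - (elim conjE, assumption)+

lemma star_superstr: "u \<in> superstr E S \<Longrightarrow> star u \<in> superstr E (star_set E star S)"
  using star_image by blast

lemma star_individual: "s \<in> S \<Longrightarrow> star s = s"
  using star_individuals by blast

lemma transfer_principle:
  "range a \<subseteq> superstr E S \<Longrightarrow>
    bq_true E (superstr E S) \<Phi> a \<longleftrightarrow>
    bq_true E (superstr E (star_set E star S)) \<Phi> (star \<circ> a)"
  using model unfolding polysaturated_model_def by (elim conjE) (erule allE, erule allE, erule mp)

lemma saturation:
  assumes "\<And>B. B \<in> \<F> \<Longrightarrow> internal_set E S star B" "|\<F>| \<le>o \<kappa>"
    and "\<And>\<G>. \<lbrakk>\<G> \<subseteq> \<F>; finite \<G>\<rbrakk> \<Longrightarrow> \<Inter>\<G> \<noteq> {}"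
  shows "\<Inter>\<F> \<noteq> {}"
proof -
  have "(\<forall>B\<in>\<F>. internal_set E S star B) \<and> |\<F>| \<le>o \<kappa> \<and>
      (\<forall>\<G>. \<G> \<subseteq> \<F> \<and> finite \<G> \<longrightarrow> \<Inter>\<G> \<noteq> {}) \<longrightarrow> \<Inter>\<F> \<noteq> {}"
    using model unfolding polysaturated_model_def by (elim conjE) (erule spec)
  then show ?thesis using assms by blast
qed

lemma elts_mkset: "B \<subseteq> S \<Longrightarrow> elts E (mkset E B) = B"
  using mkset_eq[OF ext_E over_S, of B 0] by (simp add: elts_def)

lemma individual_superstr: "s \<in> S \<Longrightarrow> s \<in> superstr E S"
  unfolding superstr_def by (auto intro: exI[of _ 0])

lemma star_elts:
  assumes "u \<in> superstr E S" "v \<in> superstr E S" "u \<in> elts E v"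
  shows "star u \<in> elts E (star v)"
  using transfer_principle[of "\<lambda>i. if i = 0 then u else v" "BQ_In 0 1"] assms by auto

lemma subset_star_set:
  assumes "B \<subseteq> S"
  shows "B \<subseteq> star_set E star B"
proof
  fix z assume "z \<in> B"
  then have "star z \<in> elts E (star (mkset E B))"
    using assms
    by (intro star_elts individual_superstr mkset_superstr[OF ext_E over_S])
      (auto simp: elts_mkset)
  then show "z \<in> star_set E star B"
    using \<open>z \<in> B\<close> assms by (auto simp: star_set_def star_individual)
qed

text \<open>
  This is transfer of \<open>\<forall>z\<in>A. z \<notin> B\<close>.  In the nonstandard universe the quantifier ranges only over
  objects of the superstructure over \<open>*S\<close>.  Superstructures are transitive, so this includes all
  elements of \<open>*A\<close>.
\<close>

lemma star_set_disjoint: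
  assumes "A \<subseteq> S" "B \<subseteq> S" "A \<inter> B = {}"
  shows "star_set E star A \<inter> star_set E star B = {}"
proof -
  let ?a = "\<lambda>i::nat. if i = 0 then mkset E A else mkset E B"
  let ?\<Phi> = "BQ_All 2 0 (BQ_Not (BQ_In 2 1))"
  have A: "mkset E A \<in> superstr E S" and B: "mkset E B \<in> superstr E S"
    using assms by (auto intro: mkset_superstr[OF ext_E over_S])
  have "bq_true E (superstr E S) ?\<Phi> ?a"
    using assms by (auto simp: elts_mkset)
  then have "bq_true E (superstr E (star_set E star S)) ?\<Phi> (star \<circ> ?a)"
    using A B by (subst (asm) transfer_principle) auto
  moreover have "star_set E star A \<subseteq> superstr E (star_set E star S)"
    unfolding star_set_def[of E star A]
    by (rule elts_superstr[OF over_star_S star_superstr[OF A]])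
  ultimately show ?thesis
    by (auto simp: star_set_def)
qed

text \<open>
  Transfer of \<open>B \<in> {B}\<close> makes the object \<open>star B\<close> an element of a standard set.  Nonemptiness
  ensures that this object is a set: bounded formulas do not tell the empty set from an individual.
\<close>

lemma internal_star_set:
  assumes "B \<subseteq> S" "B \<noteq> {}"
  shows "internal_set E S star (star_set E star B)"
proof -
  let ?b = "mkset E B"
  let ?C = "mkset E {?b}"
  have b: "{?b} \<subseteq> level E S 1"
    using mkset_level[OF ext_E over_S, of B 0] assms by simp
  have C: "?C \<in> superstr E S"
    using mkset_level[OF ext_E over_S b] unfolding superstr_def by blast
  have "?b \<in> elts E ?C"
    using mkset_eq[OF ext_E over_S b] by (simp add: elts_def)
  then have "star ?b \<in> elts E (star ?C)"
    using C mkset_superstr[OF ext_E over_S assms(1)] by (intro star_elts)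
  moreover have "E (star ?b) = Some (star_set E star B)"
    using subset_star_set[OF assms(1)] assms(2)
    by (auto simp: star_set_def elts_def split: option.splits)
  ultimately show ?thesis
    using C unfolding internal_set_def by blast
qed

text \<open>
  For star images of standard sets, standard points suffice to witness the finite intersection
  property, and the cardinality bound is automatic because every standard set is an object of the
  superstructure.
\<close>

lemma star_sets_saturated:
  assumes sub: "\<And>B. B \<in> \<N> \<Longrightarrow> B \<subseteq> S"
    and fip: "\<And>\<G>. \<lbrakk>\<G> \<subseteq> \<N>; finite \<G>\<rbrakk> \<Longrightarrow> \<Inter>\<G> \<noteq> {}"
  shows "(\<Inter>B\<in>\<N>. star_set E star B) \<noteq> {}"
proof (rule saturation)
  fix B' assume "B' \<in> star_set E star ` \<N>"
  then obtain B where B: "B \<in> \<N>" "B' = star_set E star B" by blast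
  have "B \<noteq> {}" using fip[of "{B}"] B by auto
  then show "internal_set E S star B'"
    using internal_star_set sub B by blast
next
  have "star_set E star ` \<N> = (\<lambda>u. elts E (star u)) ` mkset E ` \<N>"
    by (auto simp: star_set_def)
  then have "|star_set E star ` \<N>| \<le>o |mkset E ` \<N>|"
    using card_of_image by metis
  also have "|mkset E ` \<N>| \<le>o |superstr E S|"
    using sub by (intro card_of_mono1) (auto intro: mkset_superstr[OF ext_E over_S])
  finally show "|star_set E star ` \<N>| \<le>o \<kappa>"
    using card_superstr by (rule ordLeq_transitive)
next
  fix \<G> assume "\<G> \<subseteq> star_set E star ` \<N>" "finite \<G>"
  then obtain \<H> where H: "\<H> \<subseteq> \<N>" "finite \<H>" "\<G> = star_set E star ` \<H>"
    by (meson finite_subset_image)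
  then obtain z where "z \<in> \<Inter>\<H>" using fip[of \<H>] by blast
  have "z \<in> star_set E star B" if "B \<in> \<H>" for B
    using that \<open>z \<in> \<Inter>\<H>\<close> H(1) sub[of B] subset_star_set[of B] by auto
  then have "z \<in> \<Inter>\<G>"
    unfolding H(3) by simp
  then show "\<Inter>\<G> \<noteq> {}" by blast
qed

lemma in_closure_of_iff_halo:
  assumes "topspace T \<subseteq> S" "A \<subseteq> topspace T" "x \<in> topspace T"
  shows "x \<in> T closure_of A \<longleftrightarrow> halo E star T x \<inter> star_set E star A \<noteq> {}"
proof
  let ?N = "{U. openin T U \<and> x \<in> U}"
  assume x: "x \<in> T closure_of A"
  have "(\<Inter>B\<in>insert A ?N. star_set E star B) \<noteq> {}"
  proof (rule star_sets_saturated)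
    fix B assume "B \<in> insert A ?N"
    then show "B \<subseteq> S" using assms openin_subset by blast
  next
    fix \<G> assume G: "\<G> \<subseteq> insert A ?N" "finite \<G>"
    \<comment> \<open>Adjoining the whole space matters when \<open>\<G> \<subseteq> {A}\<close>: the intersection would otherwise be
      \<open>\<Inter>{} = UNIV\<close>, which need not be open in \<open>T\<close>.\<close>
    have "openin T (\<Inter>(insert (topspace T) (\<G> - {A})))"
      using G by (intro openin_Inter) auto
    moreover have "x \<in> \<Inter>(insert (topspace T) (\<G> - {A}))"
      using G assms by blast
    ultimately obtain z where "z \<in> A" "z \<in> \<Inter>(insert (topspace T) (\<G> - {A}))"
      using x unfolding in_closure_of by blast
    then have "z \<in> \<Inter>\<G>" by blast
    then show "\<Inter>\<G> \<noteq> {}" by blast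
  qed
  then show "halo E star T x \<inter> star_set E star A \<noteq> {}"
    unfolding halo_def by auto
next
  assume "halo E star T x \<inter> star_set E star A \<noteq> {}"
  then obtain y where y: "y \<in> halo E star T x" "y \<in> star_set E star A" by blast
  have "U \<inter> A \<noteq> {}" if "openin T U" "x \<in> U" for U
  proof -
    have "y \<in> star_set E star U"
      using y that by (auto simp: halo_def)
    moreover have "U \<subseteq> S" "A \<subseteq> S"
      using that assms openin_subset by blast+
    ultimately show ?thesis
      using star_set_disjoint[of U A] y by blast
  qed
  then show "x \<in> T closure_of A"
    using assms unfolding in_closure_of by blast
qed

end

lemma ext_subset_topspace:
  assumes "\<And>p. \<nu> p \<subseteq> topspace T"
  shows "ext E star T \<nu> \<phi> \<subseteq> topspace T"
  using assms by (induction \<phi>) auto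

theorem proposition5p1:
  fixes E :: "'u \<rightharpoonup> 'u set"
    and T :: "'u topology"
    and \<rho> :: "real \<Rightarrow> 'u"
    and star :: "'u \<Rightarrow> 'u"
    and \<kappa> :: "'k rel"
    and \<nu> :: "'p \<Rightarrow> 'u set"
    and \<phi> :: "'p form"
  assumes "inj \<rho>"
    and "polysaturated_model E (topspace T \<union> range \<rho>) star \<kappa>"
    and "\<And>p. \<nu> p \<subseteq> topspace T"
  shows "ext E star T \<nu> (Dia \<phi>) = T closure_of (ext E star T \<nu> \<phi>) \<and>
         ext E star T \<nu> (Box \<phi>) = T interior_of (ext E star T \<nu> \<phi>)"
proof -
  have dia: "ext E star T \<nu> (Dia \<psi>) = T closure_of (ext E star T \<nu> \<psi>)" for \<psi> :: "'p form"
  proof -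
    have "x \<in> T closure_of (ext E star T \<nu> \<psi>) \<longleftrightarrow>
        halo E star T x \<inter> star_set E star (ext E star T \<nu> \<psi>) \<noteq> {}"
      if "x \<in> topspace T" for x
    proof (rule in_closure_of_iff_halo[OF assms(2) _ _ that])
      show "ext E star T \<nu> \<psi> \<subseteq> topspace T"
        by (rule ext_subset_topspace[OF assms(3)])
    qed simp
    then show ?thesis
      using closure_of_subset_topspace[of T "ext E star T \<nu> \<psi>"] by auto
  qed
  have "ext E star T \<nu> (Box \<phi>) = topspace T - ext E star T \<nu> (Dia (Neg \<phi>))"
    by (simp add: Box_def)
  also have "\<dots> = T interior_of (ext E star T \<nu> \<phi>)"
    by (simp only: dia interior_of_closure_of ext.simps(3))
  finally show ?thesis
    using dia by blast
qed

end
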